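(* Let $G$ be a finite group and let $H$ be a subgroup of $G$ with $H \neq L(H,\mathrm{Aut}(G))$. If $p$ and $q$ are the smallest primes dividing $|\mathrm{Aut}(G)|$ and $|H|$ respectively, then \[ \Pr(H,\mathrm{Aut}(G)) \leq \frac{p+q-1}{pq}. \] In particular, if $q\geq p$ then $\Pr(H,\mathrm{Aut}(G)) \leq \frac{2p-1}{p^2} \leq \frac{3}{4}$.
   Context: For a subgroup $H$ of a finite group $G$ with automorphism group $\mathrm{Aut}(G)$: $\Pr(H,\mathrm{Aut}(G)) := \dfrac{|\{(x,\alpha)\in H\times \mathrm{Aut}(G) : \alpha(x)=x\}|}{|H||\mathrm{Aut}(G)|}$ and $L(H,\mathrm{Aut}(G)) := \{x\in H : \alpha(x)=x \text{ for all } \alpha\in \mathrm{Aut}(G)\}$. *)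

theory Defs
  imports Complex_Main "HOL-Algebra.Bij" "HOL-Computational_Algebra.Primes"
begin

text \<open>
  The library's set \<^term>\<open>auto G\<close> consists of the automorphisms of \<open>G\<close> that are extensional
  on \<^term>\<open>carrier G\<close>, so each automorphism is counted exactly once.
\<close>

definition Pr_Aut :: "'a set \<Rightarrow> ('a, 'b) monoid_scheme \<Rightarrow> real" where
  "Pr_Aut H G =
     real (card {(x, \<alpha>). x \<in> H \<and> \<alpha> \<in> auto G \<and> \<alpha> x = x}) /
       (real (card H) * real (card (auto G)))"

definition L_Aut :: "'a set \<Rightarrow> ('a, 'b) monoid_scheme \<Rightarrow> 'a set" where
  "L_Aut H G = {x \<in> H. \<forall>\<alpha>\<in>auto G. \<alpha> x = x}"

definition smallest_prime_divisor :: "nat \<Rightarrow> nat \<Rightarrow> bool" where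
  "smallest_prime_divisor p n \<longleftrightarrow>
     prime p \<and> p dvd n \<and> (\<forall>r. prime r \<and> r dvd n \<longrightarrow> p \<le> r)"

end

theory Submission
  imports Defs "HOL-Algebra.Coset"
begin

text \<open>
  Write \<open>A\<close> for the automorphism group and \<open>L\<close> for \<^term>\<open>L_Aut H G\<close>. Counting the pairs
  \<open>(x, \<alpha>)\<close> with \<open>\<alpha> x = x\<close> one \<open>x\<close> at a time gives the sum over \<open>x \<in> H\<close> of the orders of the
  stabilizers of \<open>x\<close> in \<open>A\<close>. An element of \<open>L\<close> contributes \<open>|A|\<close>; any other element has a proper
  stabilizer, whose index, a divisor of \<open>|A|\<close> greater than 1, is at least \<open>p\<close>, so it contributes
  at most \<open>|A| / p\<close>. For the same reason \<open>L\<close>, a proper subgroup of \<open>H\<close>, has at most \<open>|H| / q\<close>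
  elements. Hence, with \<open>t = |L| / |H| \<le> 1 / q\<close>, the probability is at most
  \<open>t + (1 - t) / p\<close>. This is nondecreasing in \<open>t\<close>, and at \<open>t = 1 / q\<close> it equals
  \<open>(p + q - 1) / (p q)\<close>, which is in turn nonincreasing in \<open>q\<close>; so for \<open>q \<ge> p\<close> it is bounded by
  its value at \<open>q = p\<close>.
\<close>

text \<open>
  By Lagrange, the index of the subgroup divides the group order; when it exceeds 1 it has a prime
  factor, which is at least \<open>p\<close>.
\<close>

lemma (in group) card_proper_subgroup_le:
  assumes fin: "finite (carrier G)" and K: "subgroup K G" and proper: "K \<noteq> carrier G"
    and p: "smallest_prime_divisor p (card (carrier G))"
  shows "p * card K \<le> card (carrier G)"
proof -
  let ?i = "card (rcosets K)"
  have lag: "?i * card K = card (carrier G)"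
    using lagrange[OF K] by (simp add: order_def)
  have "?i \<noteq> 1"
  proof
    assume "?i = 1"
    then have "card K = card (carrier G)" using lag by simp
    then show False
      using card_subset_eq[OF fin subgroup.subset[OF K]] proper by blast
  qed
  then obtain r where r: "prime r" "r dvd ?i"
    using prime_factor_nat by blast
  have "p \<le> r"
    using p r lag unfolding smallest_prime_divisor_def by (metis dvd_mult2)
  moreover have "r \<le> ?i"
  proof (rule dvd_imp_le[OF r(2)])
    show "0 < ?i" using lag fin one_closed by (metis card_gt_0_iff empty_iff mult_0 neq0_conv)
  qed
  ultimately show ?thesis
    using lag by (metis le_trans mult_le_mono1)
qed

lemma (in group) subgroup_auto_stabilizer:
  assumes x: "x \<in> carrier G"
  shows "subgroup {\<alpha> \<in> auto G. \<alpha> x = x} (AutoGroup G)"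
proof -
  interpret A: group "AutoGroup G" by (rule AutoGroup)
  have car: "carrier (AutoGroup G) = auto G"
    by (simp add: AutoGroup_def)
  have mult: "(\<alpha> \<otimes>\<^bsub>AutoGroup G\<^esub> \<beta>) x = \<alpha> (\<beta> x)" if "\<alpha> \<in> auto G" "\<beta> \<in> auto G" for \<alpha> \<beta>
    using that x by (simp add: AutoGroup_def BijGroup_def auto_def compose_def)
  have one: "\<one>\<^bsub>AutoGroup G\<^esub> x = x"
    using x by (simp add: AutoGroup_def BijGroup_def)
  show ?thesis
  proof (rule A.subgroupI)
    show "{\<alpha> \<in> auto G. \<alpha> x = x} \<subseteq> carrier (AutoGroup G)"
      using car by auto
    show "{\<alpha> \<in> auto G. \<alpha> x = x} \<noteq> {}"
      using A.one_closed one car by auto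
  next
    fix \<alpha> assume a: "\<alpha> \<in> {\<alpha> \<in> auto G. \<alpha> x = x}"
    then have inv: "inv\<^bsub>AutoGroup G\<^esub> \<alpha> \<in> auto G"
      using A.inv_closed car by auto
    have "(inv\<^bsub>AutoGroup G\<^esub> \<alpha>) x = (inv\<^bsub>AutoGroup G\<^esub> \<alpha> \<otimes>\<^bsub>AutoGroup G\<^esub> \<alpha>) x"
      using mult[OF inv] a by simp
    also have "\<dots> = x"
      using A.l_inv[of \<alpha>] a car one by simp
    finally show "inv\<^bsub>AutoGroup G\<^esub> \<alpha> \<in> {\<alpha> \<in> auto G. \<alpha> x = x}"
      using inv by simp
  next
    fix \<alpha> \<beta> assume "\<alpha> \<in> {\<alpha> \<in> auto G. \<alpha> x = x}" "\<beta> \<in> {\<alpha> \<in> auto G. \<alpha> x = x}"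
    then show "\<alpha> \<otimes>\<^bsub>AutoGroup G\<^esub> \<beta> \<in> {\<alpha> \<in> auto G. \<alpha> x = x}"
      using mult A.m_closed car by auto
  qed
qed

lemma (in group) subgroup_L_Aut:
  assumes H: "subgroup H G"
  shows "subgroup (L_Aut H G) G"
proof (rule subgroupI)
  have hom: "group_hom G G \<alpha>" if "\<alpha> \<in> auto G" for \<alpha>
    using that by (auto simp: auto_def intro: group_hom.intro group_hom_axioms.intro is_group)
  note mem = subgroup.mem_carrier[OF H]
  show "L_Aut H G \<subseteq> carrier G"
    using mem by (auto simp: L_Aut_def)
  have "\<one> \<in> L_Aut H G"
    using subgroup.one_closed[OF H] group_hom.hom_one[OF hom] by (simp add: L_Aut_def)
  then show "L_Aut H G \<noteq> {}" by blast
  show "inv a \<in> L_Aut H G" if a: "a \<in> L_Aut H G" for a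
  proof -
    have "\<alpha> (inv a) = inv a" if "\<alpha> \<in> auto G" for \<alpha>
    proof -
      have "a \<in> carrier G" "\<alpha> a = a"
        using a that mem unfolding L_Aut_def by blast+
      then show ?thesis
        using group_hom.hom_inv[OF hom[OF that], of a] by simp
    qed
    then show ?thesis
      using a subgroup.m_inv_closed[OF H] by (simp add: L_Aut_def)
  qed
  show "a \<otimes> b \<in> L_Aut H G" if ab: "a \<in> L_Aut H G" "b \<in> L_Aut H G" for a b
  proof -
    have "\<alpha> (a \<otimes> b) = a \<otimes> b" if "\<alpha> \<in> auto G" for \<alpha>
    proof -
      have "a \<in> carrier G" "\<alpha> a = a" "b \<in> carrier G" "\<alpha> b = b"
        using ab that mem unfolding L_Aut_def by blast+
      then show ?thesis
        using group_hom.hom_mult[OF hom[OF that], of a b] by simp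
    qed
    then show ?thesis
      using ab subgroup.m_closed[OF H] by (simp add: L_Aut_def)
  qed
qed

lemma finite_auto:
  assumes "finite (carrier G)"
  shows "finite (auto G)"
proof (rule finite_subset)
  show "auto G \<subseteq> carrier G \<rightarrow>\<^sub>E carrier G"
    by (auto simp: auto_def Bij_def bij_betw_def PiE_def)
  show "finite (carrier G \<rightarrow>\<^sub>E carrier G)"
    using assms by (simp add: finite_PiE)
qed

theorem corollary2p4:
  fixes G :: "('a, 'b) monoid_scheme" and H :: "'a set" and p q :: nat
  assumes "group G" and "finite (carrier G)"
    and "subgroup H G"
    and "H \<noteq> L_Aut H G"
    and "smallest_prime_divisor p (card (auto G))"
    and "smallest_prime_divisor q (card H)"
  shows "Pr_Aut H G \<le> (real p + real q - 1) / (real p * real q) \<and>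
    (q \<ge> p \<longrightarrow>
       Pr_Aut H G \<le> (2 * real p - 1) / (real p)^2 \<and>
       (2 * real p - 1) / (real p)^2 \<le> 3 / 4)"
proof -
  interpret group G by fact
  interpret A: group "AutoGroup G" by (rule AutoGroup)
  have carA: "carrier (AutoGroup G) = auto G"
    by (simp add: AutoGroup_def)
  have finA: "finite (auto G)"
    using finite_auto assms(2) .
  have finH: "finite H"
    using assms(2,3) finite_subset subgroup.subset by blast
  define L where "L = L_Aut H G"
  define a h l where "a = real (card (auto G))" and "h = real (card H)" and "l = real (card L)"
  have LH: "L \<subseteq> H" by (auto simp: L_def L_Aut_def)
  have a0: "a > 0"
    using finA id_in_auto by (auto simp: a_def card_gt_0_iff)
  have h0: "h > 0"
    using finH subgroup.one_closed[OF assms(3)] by (auto simp: h_def card_gt_0_iff)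
  have p2: "real p \<ge> 2" and q2: "real q \<ge> 2"
    using assms(5,6) prime_ge_2_nat by (auto simp: smallest_prime_divisor_def)
  have ql: "real q * l \<le> h"
  proof -
    interpret HG: group "G\<lparr>carrier := H\<rparr>"
      using subgroup.subgroup_is_group[OF assms(3) assms(1)] .
    have "subgroup L (G\<lparr>carrier := H\<rparr>)"
      using subgroup_incl[OF subgroup_L_Aut[OF assms(3)] assms(3)] LH by (simp add: L_def)
    then have "q * card L \<le> card H"
      using HG.card_proper_subgroup_le[of L q] finH assms(4,6) by (simp add: L_def)
    then show ?thesis
      unfolding l_def h_def by (metis of_nat_le_iff of_nat_mult)
  qed
  define fix_card where "fix_card x = real (card {\<alpha> \<in> auto G. \<alpha> x = x})" for x
  have fix_L: "fix_card x = a" if "x \<in> L" for x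
  proof -
    have "{\<alpha> \<in> auto G. \<alpha> x = x} = auto G"
      using that by (auto simp: L_def L_Aut_def)
    then show ?thesis by (simp add: fix_card_def a_def)
  qed
  have fix_other: "fix_card x \<le> a / real p" if x: "x \<in> H - L" for x
  proof -
    have "{\<alpha> \<in> auto G. \<alpha> x = x} \<noteq> auto G"
      using x by (auto simp: L_def L_Aut_def)
    then have "p * card {\<alpha> \<in> auto G. \<alpha> x = x} \<le> card (auto G)"
      using A.card_proper_subgroup_le[OF _ subgroup_auto_stabilizer, of x p]
        x subgroup.mem_carrier[OF assms(3)] finA assms(5) by (simp add: carA)
    then have "real p * fix_card x \<le> a"
      unfolding fix_card_def a_def by (metis of_nat_le_iff of_nat_mult)
    then show ?thesis
      using p2 by (simp add: field_simps)
  qed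
  have pairs: "{(x, \<alpha>). x \<in> H \<and> \<alpha> \<in> auto G \<and> \<alpha> x = x} = (SIGMA x:H. {\<alpha> \<in> auto G. \<alpha> x = x})"
    by auto
  have "real (card {(x, \<alpha>). x \<in> H \<and> \<alpha> \<in> auto G \<and> \<alpha> x = x}) = (\<Sum>x\<in>H. fix_card x)"
    unfolding pairs using finH finA by (simp add: card_SigmaI fix_card_def)
  also have "\<dots> = (\<Sum>x\<in>H - L. fix_card x) + (\<Sum>x\<in>L. fix_card x)"
    using sum.subset_diff[OF LH finH] .
  also have "(\<Sum>x\<in>L. fix_card x) = l * a"
    using fix_L by (simp add: l_def)
  also have "(\<Sum>x\<in>H - L. fix_card x) \<le> (h - l) * (a / real p)"
    using sum_bounded_above[of "H - L" fix_card "a / real p"] fix_other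
      card_Diff_subset[OF finite_subset[OF LH finH] LH] card_mono[OF finH LH]
    by (simp add: h_def l_def of_nat_diff)
  finally have "Pr_Aut H G \<le> ((h - l) * (a / real p) + l * a) / (h * a)"
    unfolding Pr_Aut_def a_def[symmetric] h_def[symmetric]
    using a0 h0 by (simp add: divide_right_mono)
  also have "\<dots> = l / h * (1 - 1 / real p) + 1 / real p"
    using a0 h0 p2 by (simp add: field_simps)
  also have "\<dots> \<le> 1 / real q * (1 - 1 / real p) + 1 / real p"
    using ql h0 q2 p2 by (intro add_right_mono mult_right_mono) (simp_all add: field_simps)
  finally have bound: "Pr_Aut H G \<le> 1 / real q * (1 - 1 / real p) + 1 / real p" .
  have "1 / real q * (1 - 1 / real p) + 1 / real p = (real p + real q - 1) / (real p * real q)"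
    using p2 q2 by (simp add: field_simps)
  moreover have "Pr_Aut H G \<le> (2 * real p - 1) / (real p)^2" if "q \<ge> p"
  proof -
    have "1 / real q * (1 - 1 / real p) + 1 / real p
        \<le> 1 / real p * (1 - 1 / real p) + 1 / real p"
      using that p2 by (intro add_right_mono mult_right_mono) (simp_all add: field_simps)
    also have "\<dots> = (2 * real p - 1) / (real p)^2"
      using p2 by (simp add: field_simps power2_eq_square)
    finally show ?thesis using bound by linarith
  qed
  moreover have "(2 * real p - 1) / (real p)^2 \<le> 3 / 4"
  proof -
    \<comment> \<open>The factorization of \<open>3 p\<^sup>2 - 4 (2 p - 1)\<close>, whose larger root is 2.\<close>
    have "0 \<le> (3 * real p - 2) * (real p - 2)"
      using p2 by simp
    then show ?thesis
      using p2 by (simp add: field_simps power2_eq_square)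
  qed
  ultimately show ?thesis using bound by simp
qed

end
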